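(* For every $k\in\mathbb{N}$ with $k>2$ there exists a snark $G_k$ with $|V(G_k)|=18k$ and $o(G_k)\ge k$.
   Context: A snark is a cubic, cyclically 4-edge-connected graph that has no 3-edge-coloring. (Cyclically 4-edge-connected: no set of fewer than 4 edges separates the graph so that at least two of the resulting components contain cycles.) The oddness $o(H)$ of a bridgeless cubic graph $H$ is the minimum number of odd components (cycles of odd length) in any 2-factor of $H$. *)

theory Defs
  imports Main
begin

text \<open>A finite simple undirected graph is given by its vertex set \<open>V\<close> and its set \<open>E\<close> of
  edges, each edge being a two-element set of vertices.\<close>

definition simple_graph :: "'a set \<Rightarrow> 'a set set \<Rightarrow> bool" where
  "simple_graph V E \<longleftrightarrow> finite V \<and> (\<forall>e\<in>E. e \<subseteq> V \<and> card e = 2)"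

definition degree :: "'a set set \<Rightarrow> 'a \<Rightarrow> nat" where
  "degree E v = card {e \<in> E. v \<in> e}"

definition cubic :: "'a set \<Rightarrow> 'a set set \<Rightarrow> bool" where
  "cubic V E \<longleftrightarrow> (\<forall>v\<in>V. degree E v = 3)"

definition adjacency :: "'a set set \<Rightarrow> ('a \<times> 'a) set" where
  "adjacency E = {(u, v). {u, v} \<in> E}"

text \<open>Components are represented by their vertex sets: since adjacency is symmetric, its reflexive
  transitive closure is an equivalence relation.\<close>

definition components :: "'a set \<Rightarrow> 'a set set \<Rightarrow> 'a set set" where
  "components V E = V // (adjacency E)\<^sup>*"

text \<open>A cycle is given by the list of its vertices in cyclic order, without repeating the start.\<close>

definition is_cycle :: "'a set set \<Rightarrow> 'a list \<Rightarrow> bool" where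
  "is_cycle E xs \<longleftrightarrow> length xs \<ge> 3 \<and> distinct xs \<and>
     (\<forall>i < length xs. {xs ! i, xs ! (Suc i mod length xs)} \<in> E)"

definition contains_cycle :: "'a set set \<Rightarrow> 'a set \<Rightarrow> bool" where
  "contains_cycle E C \<longleftrightarrow> (\<exists>xs. is_cycle E xs \<and> set xs \<subseteq> C)"

text \<open>The case \<open>X = {}\<close> is included, so a cubic graph with this property is connected.\<close>

definition cyclically_4_edge_connected :: "'a set \<Rightarrow> 'a set set \<Rightarrow> bool" where
  "cyclically_4_edge_connected V E \<longleftrightarrow>
     \<not> (\<exists>X \<subseteq> E. card X < 4 \<and>
          (\<exists>C \<in> components V (E - X). \<exists>D \<in> components V (E - X).
             C \<noteq> D \<and> contains_cycle (E - X) C \<and> contains_cycle (E - X) D))"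

definition three_edge_colorable :: "'a set set \<Rightarrow> bool" where
  "three_edge_colorable E \<longleftrightarrow>
     (\<exists>c :: 'a set \<Rightarrow> nat. c ` E \<subseteq> {..<3} \<and>
        (\<forall>e\<in>E. \<forall>f\<in>E. e \<noteq> f \<and> e \<inter> f \<noteq> {} \<longrightarrow> c e \<noteq> c f))"

definition snark :: "'a set \<Rightarrow> 'a set set \<Rightarrow> bool" where
  "snark V E \<longleftrightarrow> simple_graph V E \<and> cubic V E \<and> cyclically_4_edge_connected V E \<and>
     \<not> three_edge_colorable E"

definition two_factor :: "'a set \<Rightarrow> 'a set set \<Rightarrow> 'a set set \<Rightarrow> bool" where
  "two_factor V E F \<longleftrightarrow> F \<subseteq> E \<and> (\<forall>v\<in>V. degree F v = 2)"

text \<open>The components of a 2-factor are cycles, so the length of a component is its number of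
  vertices.\<close>

definition odd_components :: "'a set \<Rightarrow> 'a set set \<Rightarrow> 'a set set" where
  "odd_components V F = {C \<in> components V F. odd (card C)}"

text \<open>Every bridgeless cubic graph has a 2-factor (Petersen), and then the infimum is an attained
  minimum. The value is unspecified for graphs without a 2-factor.\<close>

definition oddness :: "'a set \<Rightarrow> 'a set set \<Rightarrow> nat" where
  "oddness V E = (INF F \<in> {F. two_factor V E F}. card (odd_components V F))"

end

theory Submission
  imports Defs
begin

text \<open>The graph is a cyclic chain of \<open>k\<close> copies of a block with 18 vertices and four outgoing edges,
  consecutive copies being joined by two edges. A block consists of two copies of the Petersen graph
  minus two adjacent vertices, together with two further vertices. Whatever a 2-factor does on the
  outgoing edges, it leaves an odd component inside every block; hence the oddness is at least \<open>k\<close>.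
  The same property excludes a 3-edge-colouring: two colours would form a 2-factor, each of whose
  components is perfectly matched by one of these colours and hence even.

  In a cubic graph it suffices for cyclic 4-edge-connectivity that an edge cut with at most three
  edges has at most one vertex on one side. A vertex set that contains a block only in part cuts at
  least two of its inner edges, and two changes between consecutive full and empty blocks cut four
  edges, so a cut with at most three edges splits exactly one block and is a cut of that block with
  its four outgoing edges.\<close>

section \<open>The block\<close>

text \<open>\<open>(a, d, b)\<close> stands for an edge from vertex \<open>a\<close> of a block to vertex \<open>b\<close> of the \<open>d\<close>-th next block.
  The vertices \<open>0\<close> to \<open>7\<close> and \<open>8\<close> to \<open>15\<close> form the two Petersen fragments; in the first, \<open>2\<close> and \<open>3\<close>
  were adjacent to one deleted vertex, \<open>0\<close> and \<open>4\<close> to the other, and likewise \<open>10\<close>, \<open>11\<close> and \<open>8\<close>, \<open>12\<close>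
  in the second.\<close>

definition block :: "(nat \<times> nat \<times> nat) list" where
  "block = [
     (0,0,1), (0,0,5), (0,0,10), (1,0,2), (1,0,6), (2,0,7), (2,0,16), (3,0,5), (3,0,6), (4,0,6),
     (4,0,7), (4,0,17), (5,0,7), (8,0,9), (8,0,13), (9,0,10), (9,0,14), (10,0,15), (11,0,13),
     (11,0,14), (11,0,17), (12,0,14), (12,0,15), (12,0,16), (13,0,15), (8,1,3), (17,1,16)]"

text \<open>Found by enumerating the 37 possible restrictions of a 2-factor to a block: these are the vertex
  sets of the odd cycles that occur.\<close>

definition odd_sets :: "nat list list" where
  "odd_sets = [
     [0,1,2,5,7], [0,1,3,5,6], [1,2,4,6,7], [3,4,5,6,7],
     [8,9,10,13,15], [8,9,11,13,14], [9,10,12,14,15], [11,12,13,14,15],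
     [0,1,4,6,9,10,11,14,17], [0,1,4,6,10,11,13,15,17],
     [0,4,5,7,9,10,11,14,17], [0,4,5,7,10,11,13,15,17],
     [0,1,2,3,4,5,6,7,9,10,11,14,17], [0,1,2,3,4,5,6,7,10,11,13,15,17],
     [0,1,4,6,8,9,10,11,12,13,14,15,17], [0,4,5,7,8,9,10,11,12,13,14,15,17]]"

text \<open>\<open>f\<close> is membership in the 2-factor for the edges that start in the block, \<open>g\<close> for those that end
  in it; they differ only on the edges between blocks.\<close>

lemma odd_set_exists:
  fixes f g :: "nat \<times> nat \<times> nat \<Rightarrow> bool"
  assumes fg: "\<And>a b. g (a, 0, b) = f (a, 0, b)"
    and deg: "\<And>j. j < 18 \<Longrightarrow>
      (\<Sum>t\<leftarrow>block. case t of (a, d, b) \<Rightarrow>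
         of_bool (a = j \<and> f t) + of_bool (b = j \<and> g t)) = (2::nat)"
  shows "\<exists>S\<in>set odd_sets. \<forall>(a, d, b)\<in>set block.
      (f (a, d, b) \<and> a \<in> set S \<longrightarrow> d = 0 \<and> b \<in> set S) \<and>
      (g (a, d, b) \<and> b \<in> set S \<longrightarrow> d = 0 \<and> a \<in> set S)"
proof -
  have two_of_three: "of_bool p + (of_bool q + of_bool r) = (2::nat) \<longleftrightarrow>
      (p \<and> q \<and> \<not> r) \<or> (p \<and> \<not> q \<and> r) \<or> (\<not> p \<and> q \<and> r)" for p q r
    by (cases p; cases q; cases r) auto
  note d = deg[of 0] deg[of 1] deg[of 2] deg[of 3] deg[of 4] deg[of 5] deg[of 6] deg[of 7] deg[of 8]
    deg[of 9] deg[of 10] deg[of 11] deg[of 12] deg[of 13] deg[of 14] deg[of 15] deg[of 16] deg[of 17]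
  \<comment> \<open>Exactly two of the three edges at each vertex are chosen, which leaves a
    propositional tautology in 29 variables: 25 inner edges and two outgoing ones for each of
    \<open>f\<close> and \<open>g\<close>.\<close>
  note e = d[unfolded block_def, simplified, simplified fg two_of_three]
  show ?thesis
    unfolding block_def odd_sets_def
    apply (simp add: fg)
    using e by sat
qed

section \<open>Small cuts in a block\<close>

text \<open>Decides vertex by vertex whether to put it on one side of a cut, and abandons a branch whose
  cut exceeds the budget \<open>b\<close>. A row \<open>(n, ms, t)\<close> holds a vertex, its neighbours among the earlier
  vertices, and whether an outgoing edge at \<open>n\<close> is to be counted; \<open>xs\<close> lists the chosen vertices.\<close>

fun cut_search :: "(nat list \<Rightarrow> bool) \<Rightarrow> (nat \<times> nat list \<times> bool) list \<Rightarrow> nat \<Rightarrow> nat list \<Rightarrow> bool" where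
  "cut_search P [] b xs = P xs"
| "cut_search P ((n, ms, t) # rs) b xs = (
     (let c = of_bool t + (\<Sum>m\<leftarrow>ms. of_bool (m \<notin> set xs))
      in if c \<le> b then cut_search P rs (b - c) (n # xs) else True) \<and>
     (let c = (\<Sum>m\<leftarrow>ms. of_bool (m \<in> set xs))
      in if c \<le> b then cut_search P rs (b - c) xs else True))"

text \<open>What the search spends along \<open>s\<close>: each edge is charged at its later
  endpoint.\<close>

fun cost :: "(nat \<Rightarrow> bool) \<Rightarrow> (nat \<times> nat list \<times> bool) list \<Rightarrow> nat" where
  "cost s [] = 0"
| "cost s ((n, ms, t) # rs) =
     of_bool (t \<and> s n) + (\<Sum>m\<leftarrow>ms. of_bool (s m \<noteq> s n)) + cost s rs"

fun ordered :: "nat \<Rightarrow> (nat \<times> nat list \<times> bool) list \<Rightarrow> bool" where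
  "ordered i [] = True"
| "ordered i ((n, ms, t) # rs) = (n = i \<and> (\<forall>m\<in>set ms. m < i) \<and> ordered (Suc i) rs)"

text \<open>The branch following \<open>s\<close> has the list \<open>rev (filter s [0..<i])\<close>
  after \<open>i\<close> rows. Its budget always covers the cost of the remaining rows, so it is
  never abandoned; \<open>ordered\<close> ensures that neighbours are decided before they are
  consulted.\<close>

lemma cut_search_sound:
  assumes "cut_search P rs b (rev (filter s [0..<i]))" "ordered i rs" "cost s rs \<le> b"
  shows "P (rev (filter s [0..<i + length rs]))"
  using assms
proof (induction rs arbitrary: b i)
  case Nil
  then show ?case by simp
next
  case (Cons r rs)
  obtain n ms t where r: "r = (n, ms, t)" by (cases r)
  have n: "n = i" and ms: "\<forall>m\<in>set ms. m < i" and o: "ordered (Suc i) rs"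
    using Cons.prems(2) by (auto simp: r)
  let ?c = "of_bool (t \<and> s n) + (\<Sum>m\<leftarrow>ms. of_bool (s m \<noteq> s n)) :: nat"
  have c: "?c \<le> b" "cost s rs \<le> b - ?c"
    using Cons.prems(3) by (auto simp: r)
  have "cut_search P rs (b - ?c) (rev (filter s [0..<Suc i]))"
  proof (cases "s i")
    case True
    then have "(\<Sum>m\<leftarrow>ms. of_bool (m \<notin> set (rev (filter s [0..<i])))) =
        (\<Sum>m\<leftarrow>ms. of_bool (s m \<noteq> s n) :: nat)"
      using ms n by (intro arg_cong[of _ _ sum_list] map_cong) auto
    with Cons.prems(1) c(1) True show ?thesis
      unfolding r n cut_search.simps Let_def by (auto split: if_splits)
  next
    case False
    then have "(\<Sum>m\<leftarrow>ms. of_bool (m \<in> set (rev (filter s [0..<i])))) =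
        (\<Sum>m\<leftarrow>ms. of_bool (s m \<noteq> s n) :: nat)"
      using ms n by (intro arg_cong[of _ _ sum_list] map_cong) auto
    with Cons.prems(1) c(1) False show ?thesis
      unfolding r n cut_search.simps Let_def by (auto split: if_splits)
  qed
  from Cons.IH[OF this o c(2)] show ?case by simp
qed

text \<open>Each inner edge of \<open>block\<close> is listed at its larger endpoint;
  \<open>t\<close> adds the outgoing edges at 3, 8, 16 and 17.\<close>

definition cut_rows :: "bool \<Rightarrow> (nat \<times> nat list \<times> bool) list" where
  "cut_rows t = [
     (0, [], False), (1, [0], False), (2, [1], False), (3, [], t), (4, [], False),
     (5, [0, 3], False), (6, [1, 3, 4], False), (7, [2, 4, 5], False), (8, [], t),
     (9, [8], False), (10, [0, 9], False), (11, [], False), (12, [], False),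
     (13, [8, 11], False), (14, [9, 11, 12], False), (15, [10, 12, 13], False),
     (16, [2, 12], t), (17, [4, 11], t)]"

lemma cut_search_open: "cut_search (\<lambda>xs. length xs \<le> 1) (cut_rows True) 3 []"
  by code_simp

lemma cut_search_closed: "cut_search (\<lambda>xs. length xs = 0 \<or> length xs = 18) (cut_rows False) 1 []"
  by code_simp

definition inner :: "(nat \<Rightarrow> bool) \<Rightarrow> nat" where
  "inner s = (\<Sum>(a, d, b)\<in>set block. of_bool (d = 0 \<and> s a \<noteq> s b))"

definition link :: "(nat \<Rightarrow> bool) \<Rightarrow> (nat \<Rightarrow> bool) \<Rightarrow> nat" where
  "link s s' = (\<Sum>(a, d, b)\<in>set block. of_bool (d = 1 \<and> s a \<noteq> s' b))"

lemma link_eq: "link s s' = of_bool (s 8 \<noteq> s' 3) + of_bool (s 17 \<noteq> s' 16)"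
  by (simp add: link_def block_def)

lemma cost_closed: "cost s (cut_rows False) = inner s"
  by (simp add: inner_def block_def cut_rows_def)

lemma cost_open: "cost s (cut_rows True) = inner s + link s (\<lambda>_. False) + link (\<lambda>_. False) s"
  by (simp add: inner_def block_def cut_rows_def link_eq)

lemma ordered_cut_rows: "ordered 0 (cut_rows t)" "length (cut_rows t) = 18"
  by (simp_all add: cut_rows_def)

lemma length_filter_upt_eq:
  shows "length (filter s [0..<n]) = 0 \<Longrightarrow> \<forall>j<n. s j = False"
    and "length (filter s [0..<n]) = n \<Longrightarrow> \<forall>j<n. s j = True"
  using length_filter_less[of _ "[0..<n]" s] by (auto simp: filter_empty_conv)

text \<open>By exhaustive search, the inner edges of a block form a connected bridgeless
  graph.\<close>

lemma inner_le_1_const: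
  assumes "inner s \<le> 1"
  shows "\<exists>z. \<forall>j<18. s j = z"
proof -
  have "cut_search (\<lambda>xs. length xs = 0 \<or> length xs = 18) (cut_rows False) 1 (rev (filter s [0..<0]))"
    using cut_search_closed by simp
  from cut_search_sound[OF this ordered_cut_rows(1)] assms
  have "length (filter s [0..<18]) = 0 \<or> length (filter s [0..<18]) = 18"
    by (simp add: cost_closed ordered_cut_rows(2))
  then show ?thesis
    using length_filter_upt_eq[of s 18] by blast
qed

lemma open_block_cut:
  assumes "inner s + link s (\<lambda>_. z) + link (\<lambda>_. z) s \<le> 3"
  shows "card {j. j < 18 \<and> s j \<noteq> z} \<le> 1"
proof -
  \<comment> \<open>Disagreement with \<open>z\<close> cuts the same edges and puts the outside on
    \<open>False\<close>, the case searched.\<close>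
  let ?s = "\<lambda>j. s j \<noteq> z"
  have "inner ?s + link ?s (\<lambda>_. False) + link (\<lambda>_. False) ?s \<le> 3"
    using assms by (cases z) (auto simp: inner_def link_eq cong: if_cong)
  then have "cost ?s (cut_rows True) \<le> 3"
    by (simp only: cost_open)
  moreover have "cut_search (\<lambda>xs. length xs \<le> 1) (cut_rows True) 3 (rev (filter ?s [0..<0]))"
    using cut_search_open by simp
  ultimately have "length (filter ?s [0..<18]) \<le> 1"
    using cut_search_sound[OF _ ordered_cut_rows(1)] by (fastforce simp: ordered_cut_rows(2))
  moreover have "set (filter ?s [0..<18]) = {j. j < 18 \<and> s j \<noteq> z}"
    by auto
  ultimately show ?thesis
    by (metis card_length le_trans)
qed

section \<open>Small cuts around the cyclic chain\<close>

lemma link_cong: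
  assumes "\<And>j. j < 18 \<Longrightarrow> s j = t j" "\<And>j. j < 18 \<Longrightarrow> s' j = t' j"
  shows "link s s' = link t t'"
  using assms(1)[of 8] assms(1)[of 17] assms(2)[of 3] assms(2)[of 16] by (simp add: link_eq)

lemma link_const: "link (\<lambda>_. x) (\<lambda>_. y) = (if x = y then 0 else 2)"
  by (simp add: link_eq)

lemma ring_induct:
  assumes "i < k" "P i" "\<And>j. j < k \<Longrightarrow> P j \<Longrightarrow> P (Suc j mod k)" "q < k"
  shows "P q"
proof -
  have "P ((i + n) mod k)" for n
  proof (induction n)
    case 0
    then show ?case using assms(1,2) by simp
  next
    case (Suc n)
    then have "P (Suc ((i + n) mod k) mod k)"
      using assms(1) by (intro assms(3)) auto
    then show ?case by (simp add: mod_Suc_eq)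
  qed
  \<comment> \<open>So many steps lead from \<open>i\<close> round to \<open>q\<close>; adding
    \<open>k\<close> first keeps the natural subtraction exact.\<close>
  from this[of "q + k - i"] show ?thesis
    using assms(1,4) by simp
qed

lemma sum_ge_two:
  fixes f :: "nat \<Rightarrow> nat"
  assumes "i < k" "j < k" "i \<noteq> j"
  shows "f i + f j \<le> (\<Sum>i<k. f i)"
proof -
  have "(\<Sum>i\<in>{i, j}. f i) \<le> (\<Sum>i<k. f i)"
    using assms by (intro sum_mono2) auto
  then show ?thesis using assms by simp
qed

text \<open>Two mixed blocks would cut four inner edges, and each change of side between pure blocks
  cuts two links.\<close>

lemma small_ring_cut:
  fixes S :: "nat \<Rightarrow> nat \<Rightarrow> bool"
  assumes k: "3 \<le> k"
    and cut: "(\<Sum>i<k. inner (S i)) + (\<Sum>i<k. link (S i) (S (Suc i mod k))) \<le> 3"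
  shows "\<exists>i<k. \<exists>z. (\<forall>j<k. j \<noteq> i \<longrightarrow> (\<forall>v<18. S j v = z)) \<and> card {v. v < 18 \<and> S i v \<noteq> z} \<le> 1"
proof -
  define c where "c i = S i 0" for i
  define mixed where "mixed i \<longleftrightarrow> \<not> (\<forall>v<18. S i v = c i)" for i
  have inner: "2 \<le> inner (S i)" if "mixed i" for i
  proof (rule ccontr)
    assume "\<not> 2 \<le> inner (S i)"
    then obtain z where "\<forall>v<18. S i v = z"
      using inner_le_1_const[of "S i"] by auto
    then have "\<forall>v<18. S i v = c i"
      unfolding c_def by (metis zero_less_numeral)
    then have "\<not> mixed i"
      by (simp only: mixed_def not_not)
    with that show False by simp
  qed
  have link_pure: "link (S i) (S (Suc i mod k)) = (if c i = c (Suc i mod k) then 0 else 2)"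
    if "\<not> mixed i" "\<not> mixed (Suc i mod k)" for i
  proof -
    have "link (S i) (S (Suc i mod k)) = link (\<lambda>_. c i) (\<lambda>_. c (Suc i mod k))"
      using that unfolding mixed_def by (intro link_cong) blast+
    then show ?thesis by (simp only: link_const)
  qed
  \<comment> \<open>The links entering and leaving block \<open>i\<close> are distinct summands, so
    constant neighbours reduce the total bound to the hypothesis of
    \<open>open_block_cut\<close>.\<close>
  have one_block: ?thesis if i: "i < k" and z: "\<And>j. j < k \<Longrightarrow> j \<noteq> i \<Longrightarrow> \<forall>v<18. S j v = z" for i z
  proof -
    define p where "p = (i + k - 1) mod k"
    have p: "p < k" "p \<noteq> i" "Suc p mod k = i"
      using i k by (auto simp: p_def mod_Suc_eq mod_if)
    have n: "Suc i mod k < k" "Suc i mod k \<noteq> i"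
      using i k by (auto simp: mod_if)
    have "link (S i) (S (Suc i mod k)) = link (S i) (\<lambda>_. z)"
      using z[OF n] by (intro link_cong) blast+
    moreover have "link (S p) (S (Suc p mod k)) = link (\<lambda>_. z) (S i)"
      using z[OF p(1,2)] unfolding p(3) by (intro link_cong) blast+
    moreover have "inner (S i) \<le> (\<Sum>i<k. inner (S i))"
      using i by (intro member_le_sum) auto
    ultimately have "inner (S i) + link (S i) (\<lambda>_. z) + link (\<lambda>_. z) (S i) \<le> 3"
      using cut sum_ge_two[OF i p(1) p(2)[symmetric], of "\<lambda>i. link (S i) (S (Suc i mod k))"]
      by linarith
    with i z show ?thesis
      by (intro exI[of _ i] conjI exI[of _ z] open_block_cut) blast+
  qed
  show ?thesis
  proof (cases "\<exists>i<k. mixed i")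
    case True
    then obtain i where i: "i < k" "mixed i" by blast
    have pure: "\<not> mixed j" if "j < k" "j \<noteq> i" for j
      using sum_ge_two[OF that(1) i(1) that(2), of "\<lambda>i. inner (S i)"] inner[OF i(2)] inner[of j] cut
      by linarith
    have step: "c (Suc j mod k) = c j" if j: "j < k" "j \<noteq> i" "Suc j mod k \<noteq> i" for j
    proof (rule ccontr)
      assume "c (Suc j mod k) \<noteq> c j"
      then have "link (S j) (S (Suc j mod k)) = 2"
        using link_pure[of j] pure j k by auto
      moreover have "link (S j) (S (Suc j mod k)) \<le> (\<Sum>i<k. link (S i) (S (Suc i mod k)))"
        using j by (intro member_le_sum) auto
      moreover have "inner (S i) \<le> (\<Sum>i<k. inner (S i))"
        using i by (intro member_le_sum) auto
      ultimately show False
        using inner[OF i(2)] cut by linarith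
    qed
    \<comment> \<open>The alternative \<open>q = i\<close> lets the walk start at the mixed block
      and pass through it, where \<open>c\<close> is only the side of vertex 0.\<close>
    have others: "q = i \<or> c q = c (Suc i mod k)" if "q < k" for q
    proof -
      have "Suc j mod k = i \<or> c (Suc j mod k) = c (Suc i mod k)"
        if "j < k" "j = i \<or> c j = c (Suc i mod k)" for j
        using step[OF that(1)] that(2) by metis
      from ring_induct[where P = "\<lambda>q. q = i \<or> c q = c (Suc i mod k)", OF i(1) _ this that]
      show ?thesis by blast
    qed
    show ?thesis
    proof (rule one_block[OF i(1)])
      fix q assume q: "q < k" "q \<noteq> i"
      then have "c q = c (Suc i mod k)"
        using others by blast
      then show "\<forall>v<18. S q v = c (Suc i mod k)"
        using pure[OF q] by (simp only: mixed_def not_not)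
    qed
  next
    case False
    have "\<forall>q<k. c q = c 0"
    proof (rule ccontr)
      assume "\<not> (\<forall>q<k. c q = c 0)"
      then obtain q where q: "q < k" "c q \<noteq> c 0" by blast
      \<comment> \<open>Going from 0 to \<open>q\<close> and back gives one change away from the
        side of 0 and one away from the side of \<open>q\<close>: two different links, hence four
        cut edges.\<close>
      have change: "\<exists>j<k. c j = x \<and> c (Suc j mod k) \<noteq> x" if "i < k" "c i = x" "l < k" "c l \<noteq> x" for x i l
        using ring_induct[of i k "\<lambda>j. c j = x" l] that by blast
      obtain j where j: "j < k" "c j = c 0" "c (Suc j mod k) \<noteq> c 0"
        using change[of 0 "c 0" q] q k by auto
      obtain l where l: "l < k" "c l = c q" "c (Suc l mod k) \<noteq> c q"
        using change[of q "c q" 0] q k by auto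
      have "link (S j) (S (Suc j mod k)) = 2" "link (S l) (S (Suc l mod k)) = 2"
        using link_pure[of j] link_pure[of l] j l False k by auto
      moreover have "j \<noteq> l" using j l q by auto
      ultimately show False
        using sum_ge_two[of j k l "\<lambda>i. link (S i) (S (Suc i mod k))"] j(1) l(1) cut by linarith
    qed
    then have "\<forall>v<18. S q v = c 0" if "q < k" for q
      using False that unfolding mixed_def by metis
    then show ?thesis
      using k by (intro one_block[of 0 "c 0"]) linarith+
  qed
qed

section \<open>The chain of blocks\<close>

text \<open>Vertex \<open>j\<close> of block \<open>i\<close> is the number
  \<open>18 * i + j\<close>; reducing the block index modulo \<open>k\<close> closes the
  chain.\<close>

definition edge :: "nat \<Rightarrow> nat \<Rightarrow> nat \<times> nat \<times> nat \<Rightarrow> nat set" where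
  "edge k i = (\<lambda>(a, d, b). {18 * i + a, 18 * ((i + d) mod k) + b})"

definition ring_edges :: "nat \<Rightarrow> nat set set" where
  "ring_edges k = (\<lambda>(i, t). edge k i t) ` ({..<k} \<times> set block)"

lemma block_cases:
  assumes "(a, d, b) \<in> set block"
  shows "a < 18" "b < 18" "d = 0 \<and> a < b \<or> d = 1"
  using assms by (auto simp: block_def)

lemma vertex_eq_iff:
  fixes a b i j :: nat
  assumes "a < 18" "b < 18"
  shows "18 * i + a = 18 * j + b \<longleftrightarrow> i = j \<and> a = b"
proof
  assume eq: "18 * i + a = 18 * j + b"
  have "(18 * i + a) div 18 = i" "(18 * j + b) div 18 = j"
    using assms by simp_all
  with eq show "i = j \<and> a = b" by simp
qed simp

text \<open>The second part is where three blocks matter: with two, two forward shifts return to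
  \<open>i\<close>.\<close>

lemma mod_k_shift:
  fixes i j :: nat
  assumes "3 \<le> k" "i < k" "d \<le> 1" "d' \<le> 1"
  shows "(i + d) mod k = (i + d') mod k \<longleftrightarrow> d = d'"
    and "((i + d) mod k + d') mod k = i \<longleftrightarrow> d = 0 \<and> d' = 0"
  using assms by (auto simp: mod_if)

text \<open>Two descriptions of an edge with its ends in the same order have equal offsets; in
  opposite order both offsets are 0, against \<open>a < b\<close> for inner edges.\<close>

lemma inj_edge:
  assumes k: "3 \<le> k"
  shows "inj_on (\<lambda>(i, t). edge k i t) ({..<k} \<times> set block)"
proof (rule inj_onI, clarsimp)
  fix i a d b i' a' d' b'
  assume i: "i < k" "i' < k" and t: "(a, d, b) \<in> set block" "(a', d', b') \<in> set block"
    and eq: "edge k i (a, d, b) = edge k i' (a', d', b')"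
  note B = block_cases[OF t(1)] block_cases[OF t(2)]
  have d: "d \<le> 1" "d' \<le> 1" using B by auto
  from eq consider "i = i'" "a = a'" "(i + d) mod k = (i' + d') mod k" "b = b'"
    | "i = (i' + d') mod k" "a = b'" "(i + d) mod k = i'" "b = a'"
    using B by (auto simp: edge_def doubleton_eq_iff vertex_eq_iff)
  then show "i = i' \<and> a = a' \<and> d = d' \<and> b = b'"
  proof cases
    case 1
    then show ?thesis using mod_k_shift(1)[OF k i(1) d] by auto
  next
    case 2
    then have "d = 0 \<and> d' = 0" using mod_k_shift(2)[OF k i(1) d] by auto
    with 2 B show ?thesis by auto
  qed
qed

section \<open>Counting edges and degrees\<close>

lemma card_ring_edges:
  assumes k: "3 \<le> k"
  shows "card {e \<in> ring_edges k. Q e} = (\<Sum>t\<in>set block. \<Sum>i<k. of_bool (Q (edge k i t)))"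
proof -
  have "{e \<in> ring_edges k. Q e} =
      (\<lambda>(i, t). edge k i t) ` {p \<in> {..<k} \<times> set block. Q (edge k (fst p) (snd p))}"
    by (force simp: ring_edges_def)
  also have "card \<dots> = card {p \<in> {..<k} \<times> set block. Q (edge k (fst p) (snd p))}"
    by (intro card_image inj_on_subset[OF inj_edge[OF k]]) auto
  also have "\<dots> = (\<Sum>p\<in>{..<k} \<times> set block. of_bool (Q (edge k (fst p) (snd p))))"
    by (simp add: Int_def of_bool_def sum.If_cases)
  also have "\<dots> = (\<Sum>i<k. \<Sum>t\<in>set block. of_bool (Q (edge k i t)))"
    by (simp add: sum.cartesian_product case_prod_beta del: sum_of_bool_eq)
  finally show ?thesis by (simp only: sum.swap[of _ "{..<k}"])
qed

text \<open>The block from which an edge with offset \<open>d\<close> enters block \<open>i\<close>;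
  \<open>k\<close> is added because natural subtraction truncates.\<close>

definition prev :: "nat \<Rightarrow> nat \<Rightarrow> nat \<Rightarrow> nat" where
  "prev k d i = (i + k - d) mod k"

lemma prev_iff:
  assumes "3 \<le> k" "i < k" "i' < k" "d \<le> 1"
  shows "(i' + d) mod k = i \<longleftrightarrow> i' = prev k d i"
  using assms by (auto simp: prev_def mod_if)

lemma prev_0 [simp]: "i < k \<Longrightarrow> prev k 0 i = i"
  by (simp add: prev_def)

lemma prev_less: "3 \<le> k \<Longrightarrow> prev k d i < k"
  by (simp add: prev_def)

text \<open>Each entry of \<open>block\<close> gives one edge starting in block \<open>i\<close> and
  one ending there; the degree thus takes the local form assumed in
  \<open>odd_set_exists\<close>.\<close>

lemma degree_subgraph:
  assumes k: "3 \<le> k" and i: "i < k" and j: "j < 18" and F: "F \<subseteq> ring_edges k"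
  shows "degree F (18 * i + j) = (\<Sum>t\<leftarrow>block. case t of (a, d, b) \<Rightarrow>
     of_bool (a = j \<and> edge k i t \<in> F) + of_bool (b = j \<and> edge k (prev k d i) t \<in> F))"
proof -
  have "{e \<in> F. 18 * i + j \<in> e} = {e \<in> ring_edges k. e \<in> F \<and> 18 * i + j \<in> e}"
    using F by auto
  then have "degree F (18 * i + j) =
      (\<Sum>t\<in>set block. \<Sum>l<k. of_bool (edge k l t \<in> F \<and> 18 * i + j \<in> edge k l t))"
    by (simp only: degree_def card_ring_edges[OF k])
  also have "\<dots> = (\<Sum>t\<in>set block. case t of (a, d, b) \<Rightarrow>
     of_bool (a = j \<and> edge k i t \<in> F) + of_bool (b = j \<and> edge k (prev k d i) t \<in> F))"
  proof (rule sum.cong[OF refl], clarify)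
    fix a d b assume t: "(a, d, b) \<in> set block"
    note B = block_cases[OF t]
    have p: "prev k d i = i \<longleftrightarrow> d = 0"
      using mod_k_shift(1)[OF k i, of d 0] prev_iff[OF k i i, of d] B(3) i by auto
    have "of_bool (edge k l (a, d, b) \<in> F \<and> 18 * i + j \<in> edge k l (a, d, b)) =
        (if l = i then of_bool (a = j \<and> edge k i (a, d, b) \<in> F) else 0) +
        (if l = prev k d i then of_bool (b = j \<and> edge k (prev k d i) (a, d, b) \<in> F) else (0::nat))"
      if "l < k" for l
    proof -
      have "18 * i + j \<in> edge k l (a, d, b) \<longleftrightarrow> l = i \<and> a = j \<or> l = prev k d i \<and> b = j"
        using B j prev_iff[OF k i that, of d] by (auto simp: edge_def vertex_eq_iff)
      \<comment> \<open>Offset 0 comes with \<open>a < b\<close>, so no edge contributes at both of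
        its ends.\<close>
      moreover have "\<not> (a = j \<and> b = j \<and> prev k d i = i)"
        using p B by auto
      ultimately show ?thesis by auto
    qed
    then have "(\<Sum>l<k. of_bool (edge k l (a, d, b) \<in> F \<and> 18 * i + j \<in> edge k l (a, d, b))) =
        (\<Sum>l<k. (if l = i then of_bool (a = j \<and> edge k i (a, d, b) \<in> F) else 0) +
        (if l = prev k d i then of_bool (b = j \<and> edge k (prev k d i) (a, d, b) \<in> F) else (0::nat)))"
      by (intro sum.cong) auto
    also have "\<dots> = of_bool (a = j \<and> edge k i (a, d, b) \<in> F) +
        of_bool (b = j \<and> edge k (prev k d i) (a, d, b) \<in> F)"
      using i prev_less[OF k, of d i] by (simp add: sum.distrib sum.delta)
    finally show "(\<Sum>l<k. of_bool (edge k l (a, d, b) \<in> F \<and> 18 * i + j \<in> edge k l (a, d, b))) =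
        of_bool (a = j \<and> edge k i (a, d, b) \<in> F) +
        (of_bool (b = j \<and> edge k (prev k d i) (a, d, b) \<in> F)::nat)" .
  qed
  also have "\<dots> = (\<Sum>t\<leftarrow>block. case t of (a, d, b) \<Rightarrow>
     of_bool (a = j \<and> edge k i t \<in> F) + of_bool (b = j \<and> edge k (prev k d i) t \<in> F))"
    by (rule sum_list_distinct_conv_sum_set[symmetric]) (simp add: block_def)
  finally show ?thesis .
qed

lemma edge_mem_iff:
  assumes k: "3 \<le> k" and "i < k" "j < 18" "l < k" and t: "(a, d, b) \<in> set block"
  shows "18 * i + j \<in> edge k l (a, d, b) \<longleftrightarrow> l = i \<and> a = j \<or> l = prev k d i \<and> b = j"
  using assms block_cases[OF t] prev_iff[OF assms(1,2,4), of d] by (auto simp: edge_def vertex_eq_iff)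

lemma vertex_cases:
  fixes v k :: nat
  assumes "v < 18 * k"
  obtains i j where "i < k" "j < 18" "v = 18 * i + j"
  using assms by (intro that[of "v div 18" "v mod 18"]) auto

lemma edge_endpoints:
  assumes k: "3 \<le> k" and "i < k" and t: "(a, d, b) \<in> set block"
  shows "edge k i (a, d, b) \<subseteq> {..<18 * k}" "card (edge k i (a, d, b)) = 2"
proof -
  note B = block_cases[OF t]
  have bound: "18 * x + y < 18 * k" if "x < k" "y < 18" for x y
    using that by linarith
  have "(i + d) mod k < k"
    using k by simp
  from bound[OF this B(2)] bound[OF assms(2) B(1)]
  show "edge k i (a, d, b) \<subseteq> {..<18 * k}"
    by (simp add: edge_def)
  have "18 * i + a \<noteq> 18 * ((i + d) mod k) + b"
    using B mod_k_shift(1)[OF k assms(2), of d 0] assms(2) by (auto simp: vertex_eq_iff)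
  then show "card (edge k i (a, d, b)) = 2"
    by (simp add: edge_def)
qed

lemma simple_ring:
  assumes "3 \<le> k"
  shows "simple_graph {..<18 * k} (ring_edges k)"
  unfolding simple_graph_def
proof (intro conjI ballI)
  fix e assume "e \<in> ring_edges k"
  then obtain i a d b where "i < k" "(a, d, b) \<in> set block" "e = edge k i (a, d, b)"
    unfolding ring_edges_def by auto
  with edge_endpoints[OF assms] show "e \<subseteq> {..<18 * k}" "card e = 2"
    by simp_all
qed simp

lemma block_degrees:
  "j < 18 \<Longrightarrow> (\<Sum>(a, d, b)\<leftarrow>block. of_bool (a = j) + of_bool (b = j)) = (3::nat)"
proof -
  have "\<forall>j\<in>set [0..<18]. (\<Sum>(a, d, b)\<leftarrow>block. of_bool (a = j) + of_bool (b = j)) = (3::nat)"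
    by code_simp
  then show "j < 18 \<Longrightarrow> ?thesis" by simp
qed

lemma cubic_ring:
  assumes k: "3 \<le> k"
  shows "cubic {..<18 * k} (ring_edges k)"
  unfolding cubic_def
proof clarify
  fix v assume "v < 18 * k"
  then obtain i j where v: "i < k" "j < 18" "v = 18 * i + j" by (rule vertex_cases)
  have "edge k l t \<in> ring_edges k" if "l < k" "t \<in> set block" for l t
    using that by (auto simp: ring_edges_def)
  then have "degree (ring_edges k) v = (\<Sum>(a, d, b)\<leftarrow>block. of_bool (a = j) + of_bool (b = j))"
    unfolding v(3) degree_subgraph[OF k v(1,2) subset_refl]
    using v(1) prev_less[OF k] by (intro arg_cong[of _ _ sum_list] map_cong) (auto split: prod.split)
  then show "degree (ring_edges k) v = 3"
    using block_degrees[OF v(2)] by simp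
qed

text \<open>It avoids the outgoing edges, so its copies in all blocks leave a 2-factor.\<close>

definition block_matching :: "(nat \<times> nat \<times> nat) list" where
  "block_matching = [(0,0,1), (2,0,7), (3,0,5), (4,0,6), (8,0,13), (9,0,14), (10,0,15),
     (11,0,17), (12,0,16)]"

lemma block_matching_degrees:
  "j < 18 \<Longrightarrow> (\<Sum>(a, d, b)\<leftarrow>block. of_bool (a = j \<and> (a, d, b) \<notin> set block_matching) +
     of_bool (b = j \<and> (a, d, b) \<notin> set block_matching)) = (2::nat)"
proof -
  have "\<forall>j\<in>set [0..<18].
    (\<Sum>(a, d, b)\<leftarrow>block. of_bool (a = j \<and> (a, d, b) \<notin> set block_matching) +
       of_bool (b = j \<and> (a, d, b) \<notin> set block_matching)) = (2::nat)"
    by code_simp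
  then show "j < 18 \<Longrightarrow> ?thesis" by simp
qed

text \<open>Guarantees that the infimum in \<open>oddness\<close> ranges over a nonempty
  set.\<close>

lemma two_factor_ring:
  assumes k: "3 \<le> k"
  shows "\<exists>F. two_factor {..<18 * k} (ring_edges k) F"
proof -
  let ?F = "(\<lambda>(i, t). edge k i t) ` ({..<k} \<times> (set block - set block_matching))"
  have F: "?F \<subseteq> ring_edges k"
    by (auto simp: ring_edges_def)
  have mem: "edge k l t \<in> ?F \<longleftrightarrow> t \<notin> set block_matching" if "l < k" "t \<in> set block" for l t
  proof -
    have "(\<lambda>(i, t). edge k i t) (l, t) \<in> ?F \<longleftrightarrow> (l, t) \<in> {..<k} \<times> (set block - set block_matching)"
      using that by (intro inj_on_image_mem_iff[OF inj_edge[OF k]]) auto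
    then show ?thesis using that by simp
  qed
  have "degree ?F v = 2" if "v \<in> {..<18 * k}" for v
  proof -
    have "v < 18 * k" using that by simp
    then obtain i j where v: "i < k" "j < 18" "v = 18 * i + j" by (rule vertex_cases)
    have "degree ?F v = (\<Sum>(a, d, b)\<leftarrow>block. of_bool (a = j \<and> (a, d, b) \<notin> set block_matching) +
        of_bool (b = j \<and> (a, d, b) \<notin> set block_matching))"
      unfolding v(3) degree_subgraph[OF k v(1,2) F]
      using v(1) prev_less[OF k] mem
      by (intro arg_cong[of _ _ sum_list] map_cong) (auto split: prod.split)
    then show ?thesis
      using block_matching_degrees[OF v(2)] by simp
  qed
  with F show ?thesis
    unfolding two_factor_def by blast
qed

section \<open>Small edge cuts of the chain\<close>

lemma small_edge_cut:
  assumes k: "3 \<le> k" and cut: "card {e \<in> ring_edges k. e \<inter> A \<noteq> {} \<and> \<not> e \<subseteq> A} \<le> 3"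
  shows "card ({..<18 * k} \<inter> A) \<le> 1 \<or> card ({..<18 * k} - A) \<le> 1"
proof -
  define S where "S i j \<longleftrightarrow> 18 * i + j \<in> A" for i j
  \<comment> \<open>An edge crossing \<open>A\<close> is counted once: by \<open>inner\<close> if
    its offset is 0, by \<open>link\<close> if it is 1.\<close>
  have "(\<Sum>i<k. inner (S i)) + (\<Sum>i<k. link (S i) (S (Suc i mod k))) =
      (\<Sum>i<k. \<Sum>t\<in>set block. of_bool (edge k i t \<inter> A \<noteq> {} \<and> \<not> edge k i t \<subseteq> A))"
    unfolding inner_def link_def sum.distrib[symmetric]
  proof (intro sum.cong refl)
    fix i t assume i: "i \<in> {..<k}" and "t \<in> set block"
    moreover obtain a d b where t: "t = (a, d, b)" by (cases t)
    ultimately have "d = 0 \<or> d = 1"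
      using block_cases(3)[of a d b] by blast
    then show "(case t of (a, d, b) \<Rightarrow> of_bool (d = 0 \<and> S i a \<noteq> S i b)) +
        (case t of (a, d, b) \<Rightarrow> of_bool (d = 1 \<and> S i a \<noteq> S (Suc i mod k) b)) =
        (of_bool (edge k i t \<inter> A \<noteq> {} \<and> \<not> edge k i t \<subseteq> A) :: nat)"
      using i by (auto simp: t edge_def S_def)
  qed
  also have "\<dots> = card {e \<in> ring_edges k. e \<inter> A \<noteq> {} \<and> \<not> e \<subseteq> A}"
    by (simp only: card_ring_edges[OF k] sum.swap[of _ "{..<k}"])
  finally obtain i z where i: "i < k" and z: "\<forall>j<k. j \<noteq> i \<longrightarrow> (\<forall>v<18. S j v = z)"
    and c: "card {v. v < 18 \<and> S i v \<noteq> z} \<le> 1"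
    using small_ring_cut[OF k, of S] cut by auto
  have "{v \<in> {..<18 * k}. (v \<in> A) \<noteq> z} \<subseteq> (\<lambda>v. 18 * i + v) ` {v. v < 18 \<and> S i v \<noteq> z}"
  proof clarify
    fix v assume v: "v < 18 * k" "(v \<in> A) \<noteq> z"
    obtain l j where "l < k" "j < 18" "v = 18 * l + j" by (rule vertex_cases[OF v(1)])
    then show "v \<in> (\<lambda>v. 18 * i + v) ` {v. v < 18 \<and> S i v \<noteq> z}"
      using v z by (cases "l = i") (auto simp: S_def)
  qed
  from surj_card_le[OF _ this] c have "card {v \<in> {..<18 * k}. (v \<in> A) \<noteq> z} \<le> 1"
    by simp
  moreover have "{v \<in> {..<18 * k}. (v \<in> A) \<noteq> z} = (if z then {..<18 * k} - A else {..<18 * k} \<inter> A)"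
    by auto
  ultimately show ?thesis by (auto split: if_splits)
qed

section \<open>Cyclic edge connectivity\<close>

lemma equiv_adjacency: "equiv UNIV ((adjacency E)\<^sup>*)"
  by (intro equivI refl_rtrancl sym_rtrancl trans_rtrancl)
    (auto simp: sym_def adjacency_def insert_commute)

lemma component_closed:
  assumes "C \<in> components V E" "{u, v} \<in> E" "u \<in> C"
  shows "v \<in> C"
proof -
  have "(u, v) \<in> adjacency E" using assms(2) by (simp add: adjacency_def)
  then show ?thesis
    using assms(1,3) by (auto simp: components_def quotient_def intro: rtrancl_into_rtrancl)
qed

lemma components_disjoint:
  assumes "C \<in> components V E" "D \<in> components V E" "C \<noteq> D"
  shows "C \<inter> D = {}"
proof -
  have "components V E \<subseteq> UNIV // (adjacency E)\<^sup>*"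
    by (auto simp: components_def quotient_def)
  then show ?thesis
    using quotient_disj[OF equiv_adjacency] assms by blast
qed

text \<open>A cycle has at least three distinct vertices, all in \<open>V\<close>; a component
  containing one is too large for the small side in \<open>small_edge_cut\<close>.\<close>

lemma contains_cycle_card:
  assumes "contains_cycle E C" "E \<subseteq> E'" "simple_graph V E'"
  shows "1 < card (V \<inter> C)"
proof -
  obtain xs where xs: "3 \<le> length xs" "distinct xs" "set xs \<subseteq> C"
    "\<And>i. i < length xs \<Longrightarrow> {xs ! i, xs ! (Suc i mod length xs)} \<in> E"
    using assms(1) by (auto simp: contains_cycle_def is_cycle_def)
  have "set xs \<subseteq> V"
  proof
    fix x assume "x \<in> set xs"
    then obtain i where "i < length xs" "x = xs ! i" by (auto simp: in_set_conv_nth)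
    then show "x \<in> V"
      using xs(4)[of i] assms(2,3) unfolding simple_graph_def by blast
  qed
  then have "card (set xs) \<le> card (V \<inter> C)"
    using xs(3) assms(3) by (intro card_mono) (auto simp: simple_graph_def)
  then show ?thesis
    using xs(1) distinct_card[OF xs(2)] by simp
qed

text \<open>An edge leaving the component \<open>C\<close> must have been deleted, so the cut around
  \<open>C\<close> has at most three edges, although the cycles put at least two vertices on either
  side.\<close>

lemma cyclically_4_ring:
  assumes k: "3 \<le> k"
  shows "cyclically_4_edge_connected {..<18 * k} (ring_edges k)"
  unfolding cyclically_4_edge_connected_def
proof clarify
  let ?V = "{..<18 * k}" and ?E = "ring_edges k"
  fix X C D
  assume X: "X \<subseteq> ?E" "card X < 4"
    and C: "C \<in> components ?V (?E - X)" and D: "D \<in> components ?V (?E - X)" and "C \<noteq> D"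
    and cyc: "contains_cycle (?E - X) C" "contains_cycle (?E - X) D"
  have card: "1 < card (?V \<inter> C)" "1 < card (?V \<inter> D)"
    using contains_cycle_card[OF cyc(1) _ simple_ring[OF k]]
      contains_cycle_card[OF cyc(2) _ simple_ring[OF k]] by auto
  have "?V \<inter> D \<subseteq> ?V - C"
    using components_disjoint[OF C D \<open>C \<noteq> D\<close>] by auto
  then have "card (?V \<inter> D) \<le> card (?V - C)"
    by (intro card_mono) auto
  moreover have "e \<in> X" if e: "e \<in> ?E" "e \<inter> C \<noteq> {}" "\<not> e \<subseteq> C" for e
  proof (rule ccontr)
    assume "e \<notin> X"
    obtain u v where "u \<in> e \<inter> C" "v \<in> e - C" using e by auto
    moreover have "card e = 2"
      using e(1) simple_ring[OF k] by (auto simp: simple_graph_def)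
    ultimately have "e = {u, v}"
      by (auto simp: card_2_iff)
    with component_closed[OF C, of u v] \<open>e \<notin> X\<close> e(1) \<open>u \<in> e \<inter> C\<close> \<open>v \<in> e - C\<close>
    show False by auto
  qed
  then have "{e \<in> ?E. e \<inter> C \<noteq> {} \<and> \<not> e \<subseteq> C} \<subseteq> X" by auto
  then have "card {e \<in> ?E. e \<inter> C \<noteq> {} \<and> \<not> e \<subseteq> C} \<le> card X"
    using X(1) by (intro card_mono) (auto simp: ring_edges_def intro: finite_subset)
  ultimately show False
    using small_edge_cut[OF k, of C] X(2) card by linarith
qed

section \<open>Oddness and edge colourings\<close>

text \<open>A closed set of vertices is a union of components; such sets avoid tracing the cycles of
  a 2-factor.\<close>

definition closed_under :: "'a set set \<Rightarrow> 'a set \<Rightarrow> bool" where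
  "closed_under F S \<longleftrightarrow> (\<forall>e\<in>F. e \<inter> S \<noteq> {} \<longrightarrow> e \<subseteq> S)"

lemma odd_sets_props: "S \<in> set odd_sets \<Longrightarrow> odd (card (set S)) \<and> set S \<subseteq> {..<18}"
proof -
  have "\<forall>S\<in>set odd_sets. odd (length S) \<and> distinct S \<and> (\<forall>j\<in>set S. j < 18)"
    by code_simp
  then show "S \<in> set odd_sets \<Longrightarrow> ?thesis"
    by (auto simp: distinct_card)
qed

lemma odd_closed_set_in_block:
  assumes k: "3 \<le> k" and F: "two_factor {..<18 * k} (ring_edges k) F" and i: "i < k"
  shows "\<exists>S. odd (card S) \<and> S \<subseteq> {18 * i..<18 * i + 18} \<and> closed_under F S"
proof -
  let ?f = "\<lambda>t. edge k i t \<in> F"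
  let ?g = "\<lambda>(a, d, b). edge k (prev k d i) (a, d, b) \<in> F"
  have sub: "F \<subseteq> ring_edges k"
    using F by (simp add: two_factor_def)
  have deg: "(\<Sum>t\<leftarrow>block. case t of (a, d, b) \<Rightarrow> of_bool (a = j \<and> ?f t) + of_bool (b = j \<and> ?g t)) =
      (2::nat)" if j: "j < 18" for j
  proof -
    have "18 * i + j \<in> {..<18 * k}" using i j by simp
    then have "degree F (18 * i + j) = 2"
      using F unfolding two_factor_def by blast
    moreover have "(\<lambda>t. case t of (a, d, b) \<Rightarrow> of_bool (a = j \<and> ?f t) + of_bool (b = j \<and> ?g t)) =
       (\<lambda>t. case t of (a, d, b) \<Rightarrow> of_bool (a = j \<and> edge k i t \<in> F) +
          (of_bool (b = j \<and> edge k (prev k d i) t \<in> F) :: nat))"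
      by (auto simp: fun_eq_iff)
    ultimately show ?thesis
      using degree_subgraph[OF k i j sub] by simp
  qed
  have "?g (a, 0, b) = ?f (a, 0, b)" for a b
    using i by simp
  from odd_set_exists[of ?g ?f, OF this deg]
  obtain S where S: "S \<in> set odd_sets" and
    clos: "\<forall>(a, d, b)\<in>set block. (?f (a, d, b) \<and> a \<in> set S \<longrightarrow> d = 0 \<and> b \<in> set S) \<and>
      (?g (a, d, b) \<and> b \<in> set S \<longrightarrow> d = 0 \<and> a \<in> set S)"
    by blast
  note S' = odd_sets_props[OF S]
  let ?S = "(\<lambda>j. 18 * i + j) ` set S"
  have "closed_under F ?S"
    unfolding closed_under_def
  proof (intro ballI impI)
    fix e assume e: "e \<in> F" "e \<inter> ?S \<noteq> {}"
    have "e \<in> ring_edges k" using e(1) sub by blast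
    then obtain l a d b where l: "l < k" and t: "(a, d, b) \<in> set block" and el: "e = edge k l (a, d, b)"
      unfolding ring_edges_def by auto
    obtain j where j: "j \<in> set S" "18 * i + j \<in> e" using e(2) by auto
    have cl: "?f (a, d, b) \<and> a \<in> set S \<longrightarrow> d = 0 \<and> b \<in> set S"
      "?g (a, d, b) \<and> b \<in> set S \<longrightarrow> d = 0 \<and> a \<in> set S"
      using clos t by auto
    have "j < 18" using j(1) S' by auto
    with j(2) have "l = i \<and> a = j \<or> l = prev k d i \<and> b = j"
      using edge_mem_iff[OF k i _ l t] by (simp add: el)
    \<comment> \<open>The clause \<open>d = 0\<close> in \<open>cl\<close> rules out edges between
      blocks, and \<open>prev k 0 i = i\<close> then merges the two cases.\<close>
    then have "d = 0 \<and> l = i \<and> a \<in> set S \<and> b \<in> set S"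
      using cl e(1) j(1) i by (auto simp: el)
    then show "e \<subseteq> ?S"
      using i by (auto simp: el edge_def)
  qed
  moreover have "card ?S = card (set S)"
    by (intro card_image) (auto simp: inj_on_def)
  moreover have "?S \<subseteq> {18 * i..<18 * i + 18}"
    using S' by auto
  ultimately show ?thesis
    using S' by metis
qed

text \<open>A closed set is the disjoint union of the components of its vertices; if all were even,
  so would be its cardinality.\<close>

lemma odd_component_in_closed:
  assumes "finite S" "odd (card S)" "closed_under F S" "S \<subseteq> V"
  shows "\<exists>C\<in>odd_components V F. C \<subseteq> S"
proof (rule ccontr)
  let ?r = "(adjacency F)\<^sup>*"
  assume none: "\<not> ?thesis"
  have into: "y \<in> S" if "(x, y) \<in> ?r" "x \<in> S" for x y
    using that
  proof (induction rule: rtrancl_induct)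
    case (step y z)
    then show ?case
      using assms(3) by (force simp: closed_under_def adjacency_def)
  qed simp
  have sub: "C \<subseteq> S" if "C \<in> S // ?r" for C
    using that into by (auto simp: quotient_def)
  have "\<Union>(S // ?r) = S"
    using sub by (auto simp: quotient_def)
  moreover have "2 dvd card (\<Union>(S // ?r))"
  proof (rule dvd_partition)
    show "finite (\<Union>(S // ?r))"
      using assms(1) \<open>\<Union>(S // ?r) = S\<close> by simp
    show "\<forall>C\<in>S // ?r. 2 dvd card C"
    proof
      fix C assume C: "C \<in> S // ?r"
      then have "C \<in> components V F"
        using assms(4) by (auto simp: components_def quotient_def)
      then show "2 dvd card C"
        using none sub[OF C] by (auto simp: odd_components_def)
    qed
    show "\<forall>C\<in>S // ?r. \<forall>D\<in>S // ?r. C \<noteq> D \<longrightarrow> C \<inter> D = {}"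
      using components_disjoint[of _ S F] by (simp add: components_def)
  qed
  ultimately show False using assms(2) by simp
qed

text \<open>Odd components are nonempty and the blocks are disjoint, so those chosen in different
  blocks differ.\<close>

lemma odd_components_ring:
  assumes k: "3 \<le> k" and F: "two_factor {..<18 * k} (ring_edges k) F"
  shows "k \<le> card (odd_components {..<18 * k} F)"
proof -
  let ?V = "{..<18 * k}"
  have "\<exists>C\<in>odd_components ?V F. C \<subseteq> {18 * i..<18 * i + 18}" if i: "i < k" for i
  proof -
    obtain S where S: "odd (card S)" "S \<subseteq> {18 * i..<18 * i + 18}" "closed_under F S"
      using odd_closed_set_in_block[OF k F i] by blast
    have "finite S" "S \<subseteq> ?V"
      using S(2) i by (auto intro: finite_subset)
    from odd_component_in_closed[OF this(1) S(1,3) this(2)] S(2) show ?thesis by blast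
  qed
  then obtain C where C: "\<And>i. i < k \<Longrightarrow> C i \<in> odd_components ?V F"
    "\<And>i. i < k \<Longrightarrow> C i \<subseteq> {18 * i..<18 * i + 18}"
    by metis
  have "inj_on C {..<k}"
  proof (rule inj_onI)
    fix i j assume ij: "i \<in> {..<k}" "j \<in> {..<k}" "C i = C j"
    have "C i \<noteq> {}" using C(1)[of i] ij by (auto simp: odd_components_def)
    then obtain v where "v \<in> C i" by auto
    then have "18 * i \<le> v" "v < 18 * i + 18" "18 * j \<le> v" "v < 18 * j + 18"
      using C(2)[of i] C(2)[of j] ij by auto
    then show "i = j" by linarith
  qed
  moreover have "finite (odd_components ?V F)"
    by (auto simp: odd_components_def components_def quotient_def)
  ultimately show ?thesis
    using card_inj_on_le[of C "{..<k}" "odd_components ?V F"] C(1) by auto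
qed

lemma oddness_ring:
  assumes "3 \<le> k"
  shows "k \<le> oddness {..<18 * k} (ring_edges k)"
  unfolding oddness_def
  using two_factor_ring[OF assms] odd_components_ring[OF assms] by (intro cINF_greatest) auto

text \<open>The three edges at a vertex have distinct colours, so each colour occurs there exactly
  once.\<close>

lemma coloring_two_factor:
  assumes cub: "cubic V E"
    and c: "c ` E \<subseteq> {..<3::nat}" "\<forall>e\<in>E. \<forall>f\<in>E. e \<noteq> f \<and> e \<inter> f \<noteq> {} \<longrightarrow> c e \<noteq> c f"
  shows "two_factor V E {e \<in> E. c e \<noteq> 0}" "v \<in> V \<Longrightarrow> \<exists>e\<in>E. v \<in> e \<and> c e = 1"
proof -
  have inj: "inj_on c {e \<in> E. v \<in> e}" for v
    using c(2) by (fastforce simp: inj_on_def)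
  have im: "c ` {e \<in> E. v \<in> e} = {..<3}" if "v \<in> V" for v
  proof (rule card_subset_eq)
    show "c ` {e \<in> E. v \<in> e} \<subseteq> {..<3}" using c(1) by auto
    show "card (c ` {e \<in> E. v \<in> e}) = card {..<3::nat}"
      using card_image[OF inj[of v]] cub that by (simp add: cubic_def degree_def)
  qed simp
  have "degree {e \<in> E. c e \<noteq> 0} v = 2" if "v \<in> V" for v
  proof -
    have "c ` {e \<in> {e \<in> E. c e \<noteq> 0}. v \<in> e} = c ` {e \<in> E. v \<in> e} - {0}"
      by auto
    also have "\<dots> = {1, 2}"
      using im[OF that] by auto
    finally have "card (c ` {e \<in> {e \<in> E. c e \<noteq> 0}. v \<in> e}) = 2"
      by simp
    moreover have "inj_on c {e \<in> {e \<in> E. c e \<noteq> 0}. v \<in> e}"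
      using inj[of v] by (rule inj_on_subset) auto
    ultimately show ?thesis
      by (simp only: degree_def card_image)
  qed
  then show "two_factor V E {e \<in> E. c e \<noteq> 0}"
    by (simp add: two_factor_def)
  show "\<exists>e\<in>E. v \<in> e \<and> c e = 1" if "v \<in> V"
  proof -
    have "1 \<in> c ` {e \<in> E. v \<in> e}" using im[OF that] by simp
    then show ?thesis by auto
  qed
qed

lemma not_colorable_ring:
  assumes k: "3 \<le> k"
  shows "\<not> three_edge_colorable (ring_edges k)"
proof
  let ?E = "ring_edges k" and ?V = "{..<18 * k}"
  assume "three_edge_colorable ?E"
  then obtain c :: "nat set \<Rightarrow> nat" where c: "c ` ?E \<subseteq> {..<3}"
    and proper: "\<forall>e\<in>?E. \<forall>f\<in>?E. e \<noteq> f \<and> e \<inter> f \<noteq> {} \<longrightarrow> c e \<noteq> c f"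
    unfolding three_edge_colorable_def by blast
  let ?F = "{e \<in> ?E. c e \<noteq> 0}"
  note col = coloring_two_factor[OF cubic_ring[OF k] c proper]
  obtain S where S: "odd (card S)" "S \<subseteq> {18 * 0..<18 * 0 + 18}" "closed_under ?F S"
    using odd_closed_set_in_block[OF k col(1), of 0] k by auto
  \<comment> \<open>Colour 1 is kept in \<open>?F\<close>, so its edges meeting \<open>S\<close>
    stay in \<open>S\<close> and match it perfectly, against its odd size.\<close>
  let ?P = "{e \<in> ?E. c e = 1 \<and> e \<inter> S \<noteq> {}}"
  have "S \<subseteq> ?V" using S(2) k by auto
  have S_eq: "\<Union>?P = S"
  proof
    have "e \<subseteq> S" if "e \<in> ?P" for e
      using that S(3) unfolding closed_under_def by simp
    then show "\<Union>?P \<subseteq> S" by blast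
    show "S \<subseteq> \<Union>?P"
    proof
      fix v assume "v \<in> S"
      with \<open>S \<subseteq> ?V\<close> col(2)[of v] show "v \<in> \<Union>?P" by blast
    qed
  qed
  have "2 dvd card (\<Union>?P)"
  proof (rule dvd_partition)
    show "finite (\<Union>?P)"
      unfolding S_eq using S(2) by (rule finite_subset) simp
    show "\<forall>e\<in>?P. 2 dvd card e"
      using simple_ring[OF k] by (auto simp: simple_graph_def)
    show "\<forall>e\<in>?P. \<forall>f\<in>?P. e \<noteq> f \<longrightarrow> e \<inter> f = {}"
      using proper by fastforce
  qed
  with S(1) S_eq show False by simp
qed

theorem corollary2p6:
  fixes k :: nat
  assumes "k > 2"
  shows "\<exists>(V :: nat set) (E :: nat set set).
           snark V E \<and> card V = 18 * k \<and> oddness V E \<ge> k"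
proof -
  have k: "3 \<le> k" using assms by simp
  have "snark {..<18 * k} (ring_edges k)"
    using simple_ring[OF k] cubic_ring[OF k] cyclically_4_ring[OF k] not_colorable_ring[OF k]
    by (simp add: snark_def)
  then show ?thesis
    using oddness_ring[OF k] by (intro exI[of _ "{..<18 * k}"] exI[of _ "ring_edges k"]) simp
qed

end
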